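(* Let $\alpha_1,\alpha_2,\alpha_3\in\mathbb{C}$ satisfy $2\alpha_1+2\alpha_2+\alpha_3=0$, and let $K_1,K_2\in\mathbb{C}[q_1,p_1,q_2,p_2]$ be the polynomials given in the context. Then the partial differential system in two variables $t,s$ $$dq_i=\frac{\partial K_1}{\partial p_i}dt+\frac{\partial K_2}{\partial p_i}ds,\qquad dp_i=-\frac{\partial K_1}{\partial q_i}dt-\frac{\partial K_2}{\partial q_i}ds\qquad(i=1,2)$$ satisfies the compatibility conditions $$\frac{\partial}{\partial s}\frac{\partial q_i}{\partial t}=\frac{\partial}{\partial t}\frac{\partial q_i}{\partial s},\qquad \frac{\partial}{\partial s}\frac{\partial p_i}{\partial t}=\frac{\partial}{\partial t}\frac{\partial p_i}{\partial s}\qquad(i=1,2).$$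
   Context: The polynomials are $$K_1=q_1^2p_1-p_1^2+\alpha_2q_1-\frac{q_2^2p_2}{2}-\frac{p_2^2}{2}-\frac{\alpha_3}{2}q_2+\frac32p_1p_2,$$ $$\begin{aligned}K_2=&-\alpha_3^2p_1+q_2^4p_2^2+2q_2^2p_2^3+p_2^4+2\alpha_3q_2^3p_2+4(\alpha_1+\alpha_3)q_2p_2^2+\alpha_3^2q_2^2+\alpha_3(2\alpha_1+\alpha_3)p_2\\&-p_2\big(8q_1p_1q_2p_2+6p_1q_2^2p_2+4q_1^2p_1p_2+2p_1p_2^2-p_1^2p_2+4\alpha_2q_1p_2+4\alpha_3q_1p_1+6\alpha_3p_1q_2\big).\end{aligned}$$ Here $\partial q_i/\partial t=\partial K_1/\partial p_i$, $\partial q_i/\partial s=\partial K_2/\partial p_i$, $\partial p_i/\partial t=-\partial K_1/\partial q_i$, $\partial p_i/\partial s=-\partial K_2/\partial q_i$, and the second derivatives in the compatibility conditions are computed from these by the chain rule, as functions of $q_1,p_1,q_2,p_2$. *)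

theory Defs
  imports "HOL-Analysis.Analysis"
begin

text \<open>
  Polynomials in \<open>q\<^sub>1, p\<^sub>1, q\<^sub>2, p\<^sub>2\<close> over the complex numbers are represented by the functions
  they induce; the indices 1 and 2 are the two elements of the type \<^typ>\<open>2\<close>.
\<close>

type_synonym phase_fun = "complex ^ 2 \<Rightarrow> complex ^ 2 \<Rightarrow> complex"

definition K1 :: "complex \<Rightarrow> complex \<Rightarrow> phase_fun" where
  "K1 \<alpha>\<^sub>2 \<alpha>\<^sub>3 q p =
     (q$1)^2 * p$1 - (p$1)^2 + \<alpha>\<^sub>2 * q$1 - (q$2)^2 * p$2 / 2 - (p$2)^2 / 2
     - \<alpha>\<^sub>3 / 2 * q$2 + 3 / 2 * p$1 * p$2"

definition K2 :: "complex \<Rightarrow> complex \<Rightarrow> complex \<Rightarrow> phase_fun" where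
  "K2 \<alpha>\<^sub>1 \<alpha>\<^sub>2 \<alpha>\<^sub>3 q p =
     - (\<alpha>\<^sub>3^2 * p$1) + (q$2)^4 * (p$2)^2 + 2 * (q$2)^2 * (p$2)^3 + (p$2)^4
     + 2 * \<alpha>\<^sub>3 * (q$2)^3 * p$2 + 4 * (\<alpha>\<^sub>1 + \<alpha>\<^sub>3) * q$2 * (p$2)^2
     + \<alpha>\<^sub>3^2 * (q$2)^2 + \<alpha>\<^sub>3 * (2 * \<alpha>\<^sub>1 + \<alpha>\<^sub>3) * p$2
     - p$2 * (8 * q$1 * p$1 * q$2 * p$2 + 6 * p$1 * (q$2)^2 * p$2
              + 4 * (q$1)^2 * p$1 * p$2 + 2 * p$1 * (p$2)^2 - (p$1)^2 * p$2
              + 4 * \<alpha>\<^sub>2 * q$1 * p$2 + 4 * \<alpha>\<^sub>3 * q$1 * p$1 + 6 * \<alpha>\<^sub>3 * p$1 * q$2)"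

definition partial_q :: "2 \<Rightarrow> phase_fun \<Rightarrow> phase_fun" where
  "partial_q i F q p = deriv (\<lambda>z. F (\<chi> j. if j = i then z else q$j) p) (q$i)"

definition partial_p :: "2 \<Rightarrow> phase_fun \<Rightarrow> phase_fun" where
  "partial_p i F q p = deriv (\<lambda>z. F q (\<chi> j. if j = i then z else p$j)) (p$i)"

text \<open>
  The right-hand sides that the Hamiltonian \<open>H\<close> prescribes for the derivatives of \<open>q\<^sub>i\<close> and \<open>p\<^sub>i\<close>
  with respect to the time belonging to \<open>H\<close>.
\<close>

definition flow_q :: "phase_fun \<Rightarrow> 2 \<Rightarrow> phase_fun" where
  "flow_q H i q p = partial_p i H q p"

definition flow_p :: "phase_fun \<Rightarrow> 2 \<Rightarrow> phase_fun" where
  "flow_p H i q p = - partial_q i H q p"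

text \<open>
  Derivative of \<open>F\<close> with respect to the time belonging to \<open>H\<close>: the chain rule, with the derivatives
  of the coordinates replaced by the right-hand sides above.
\<close>

definition time_deriv :: "phase_fun \<Rightarrow> phase_fun \<Rightarrow> phase_fun" where
  "time_deriv H F q p =
     (\<Sum>j\<in>UNIV. partial_q j F q p * flow_q H j q p + partial_p j F q p * flow_p H j q p)"

end

theory Submission
  imports Defs
begin

text \<open>
  The two flows commute because \<open>K\<^sub>1\<close> and \<open>K\<^sub>2\<close> are in involution. Differentiating a function \<open>F\<close>
  along the flow of \<open>H\<close> is taking the Poisson bracket \<open>{F, H}\<close>, and the right-hand sides of the
  system are, up to sign, the partial derivatives of the Hamiltonians. Hence each compatibility
  condition has the form
  \<open>{\<partial>K\<^sub>1, K\<^sub>2} = {\<partial>K\<^sub>2, K\<^sub>1}\<close>, where \<open>\<partial>\<close> is one of the four partial derivatives. The bracket is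
  antisymmetric, and mixed partial derivatives commute, so \<open>\<partial>\<close> is a derivation of it:
  \<open>\<partial>{K\<^sub>1, K\<^sub>2} = {\<partial>K\<^sub>1, K\<^sub>2} - {\<partial>K\<^sub>2, K\<^sub>1}\<close>. It therefore suffices that \<open>{K\<^sub>1, K\<^sub>2}\<close> is
  constant (lemma \<open>compatible_if_bracket_const\<close>).

  From the gradients one computes that \<open>{K\<^sub>1, K\<^sub>2}\<close> is a multiple of
  \<open>2\<alpha>\<^sub>1 + 2\<alpha>\<^sub>2 + \<alpha>\<^sub>3\<close> (lemma \<open>poisson_K1_K2\<close>), so it vanishes under the hypothesis on the
  parameters. In this way no second derivative of \<open>K\<^sub>1\<close> or \<open>K\<^sub>2\<close> has to be written down.
\<close>

section \<open>Partial derivatives of polynomial functions\<close>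

text \<open>
  The four coordinates of the phase space form one index type, so that differentiation with respect
  to a position and to a momentum is treated by a single argument.
\<close>

datatype coord = Pos 2 | Mom 2

fun coord_val :: "coord \<Rightarrow> phase_fun" where
  "coord_val (Pos i) q p = q$i"
| "coord_val (Mom i) q p = p$i"

fun along :: "coord \<Rightarrow> phase_fun \<Rightarrow> complex ^ 2 \<Rightarrow> complex ^ 2 \<Rightarrow> complex \<Rightarrow> complex" where
  "along (Pos i) F q p z = F (\<chi> j. if j = i then z else q$j) p"
| "along (Mom i) F q p z = F q (\<chi> j. if j = i then z else p$j)"

fun partial :: "coord \<Rightarrow> phase_fun \<Rightarrow> phase_fun" where
  "partial (Pos i) = partial_q i"
| "partial (Mom i) = partial_p i"

lemma partial_eq_deriv_along: "partial c F q p = deriv (along c F q p) (coord_val c q p)"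
  by (cases c) (simp_all add: partial_q_def partial_p_def along.simps[abs_def])

lemma along_coord_val: "along c F q p (coord_val c q p) = F q p"
proof -
  have "(\<chi> j. if j = i then v$i else v$j) = v" for i and v :: "complex ^ 2"
    by (simp add: vec_eq_iff)
  then show ?thesis by (cases c) simp_all
qed

text \<open>
  The sum and product rules for \<^const>\<open>deriv\<close> need differentiable arguments, since its value is
  arbitrary elsewhere. Polynomial functions are differentiable and closed under partial derivatives,
  so the rules can be iterated on them.
\<close>

inductive polynomial_phase :: "phase_fun \<Rightarrow> bool" where
  const: "polynomial_phase (\<lambda>q p. c)"
| pos: "polynomial_phase (\<lambda>q p. q$i)"
| mom: "polynomial_phase (\<lambda>q p. p$i)"
| add: "polynomial_phase F \<Longrightarrow> polynomial_phase G \<Longrightarrow> polynomial_phase (\<lambda>q p. F q p + G q p)"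
| mult: "polynomial_phase F \<Longrightarrow> polynomial_phase G \<Longrightarrow> polynomial_phase (\<lambda>q p. F q p * G q p)"

lemma polynomial_phase_uminus:
  "polynomial_phase F \<Longrightarrow> polynomial_phase (\<lambda>q p. - F q p)"
  using polynomial_phase.mult[OF polynomial_phase.const[of "-1"]] by simp

lemma polynomial_phase_diff:
  "polynomial_phase F \<Longrightarrow> polynomial_phase G \<Longrightarrow> polynomial_phase (\<lambda>q p. F q p - G q p)"
  using polynomial_phase.add[OF _ polynomial_phase_uminus] by simp

lemma polynomial_phase_divide:
  "polynomial_phase F \<Longrightarrow> polynomial_phase (\<lambda>q p. F q p / c)"
  using polynomial_phase.mult[OF _ polynomial_phase.const[of "inverse c"]]
  by (simp add: field_class.field_divide_inverse)

lemma polynomial_phase_power: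
  "polynomial_phase F \<Longrightarrow> polynomial_phase (\<lambda>q p. F q p ^ n)"
  by (induction n) (simp_all add: polynomial_phase.const polynomial_phase.mult)

lemmas polynomial_phase_intros =
  polynomial_phase.intros polynomial_phase_uminus polynomial_phase_diff polynomial_phase_divide
  polynomial_phase_power

lemma along_const: "along c (\<lambda>q p. k) q p = (\<lambda>z. k)"
  by (cases c) auto

lemma along_add: "along c (\<lambda>q p. F q p + G q p) q p = (\<lambda>z. along c F q p z + along c G q p z)"
  by (cases c) auto

lemma along_mult: "along c (\<lambda>q p. F q p * G q p) q p = (\<lambda>z. along c F q p z * along c G q p z)"
  by (cases c) auto

lemma along_pos: "along c (\<lambda>q p. q$i) q p = (if c = Pos i then (\<lambda>z. z) else (\<lambda>z. q$i))"
  by (cases c) auto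

lemma along_mom: "along c (\<lambda>q p. p$i) q p = (if c = Mom i then (\<lambda>z. z) else (\<lambda>z. p$i))"
  by (cases c) auto

lemma polynomial_phase_differentiable:
  "polynomial_phase F \<Longrightarrow> along c F q p field_differentiable at z"
  by (induction rule: polynomial_phase.induct)
    (auto simp: along_const along_add along_mult along_pos along_mom
      intro: field_differentiable_add field_differentiable_mult)

lemma partial_const: "partial c (\<lambda>q p. k) = (\<lambda>q p. 0)"
  by (intro ext) (simp add: partial_eq_deriv_along along_const)

lemma partial_pos: "partial c (\<lambda>q p. q$i) = (\<lambda>q p. if c = Pos i then 1 else 0)"
  by (intro ext) (simp add: partial_eq_deriv_along along_pos)

lemma partial_mom: "partial c (\<lambda>q p. p$i) = (\<lambda>q p. if c = Mom i then 1 else 0)"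
  by (intro ext) (simp add: partial_eq_deriv_along along_mom)

lemma partial_add:
  assumes "polynomial_phase F" "polynomial_phase G"
  shows "partial c (\<lambda>q p. F q p + G q p) = (\<lambda>q p. partial c F q p + partial c G q p)"
  by (intro ext)
    (simp add: partial_eq_deriv_along along_add polynomial_phase_differentiable assms)

lemma partial_mult:
  assumes "polynomial_phase F" "polynomial_phase G"
  shows "partial c (\<lambda>q p. F q p * G q p)
    = (\<lambda>q p. F q p * partial c G q p + partial c F q p * G q p)"
  by (intro ext)
    (simp add: partial_eq_deriv_along along_mult along_coord_val polynomial_phase_differentiable
      assms)

lemma partial_uminus:
  assumes "polynomial_phase F"
  shows "partial c (\<lambda>q p. - F q p) = (\<lambda>q p. - partial c F q p)"
  using partial_mult[OF polynomial_phase.const[of "-1"] assms] by (simp add: partial_const)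

lemma partial_diff:
  assumes "polynomial_phase F" "polynomial_phase G"
  shows "partial c (\<lambda>q p. F q p - G q p) = (\<lambda>q p. partial c F q p - partial c G q p)"
  using partial_add[OF assms(1) polynomial_phase_uminus[OF assms(2)]]
  by (simp add: partial_uminus assms)

lemma polynomial_phase_partial: "polynomial_phase F \<Longrightarrow> polynomial_phase (partial c F)"
  by (induction rule: polynomial_phase.induct)
    (auto simp: partial_const partial_pos partial_mom partial_add partial_mult
      intro!: polynomial_phase.intros)

text \<open>
  For polynomials the symmetry of second derivatives is purely algebraic: it holds for constants and
  coordinates, whose second derivatives vanish, and the product rule propagates it.
\<close>

lemma partial_commute:
  "polynomial_phase F \<Longrightarrow> partial c (partial d F) = partial d (partial c F)"
  by (induction rule: polynomial_phase.induct)
    (simp_all add: partial_const partial_pos partial_mom partial_add partial_mult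
      polynomial_phase_partial polynomial_phase.mult algebra_simps)

section \<open>The Poisson bracket and compatibility of flows\<close>

definition poisson :: "phase_fun \<Rightarrow> phase_fun \<Rightarrow> phase_fun" where
  "poisson F G q p =
     (partial (Pos 1) F q p * partial (Mom 1) G q p - partial (Mom 1) F q p * partial (Pos 1) G q p)
   + (partial (Pos 2) F q p * partial (Mom 2) G q p - partial (Mom 2) F q p * partial (Pos 2) G q p)"

lemma time_deriv_eq_poisson: "time_deriv H F = poisson F H"
  by (intro ext) (simp add: time_deriv_def poisson_def flow_q_def flow_p_def sum_2)

lemma poisson_antisym: "poisson F G q p = - poisson G F q p"
  by (simp add: poisson_def algebra_simps)

lemma poisson_uminus_left:
  "polynomial_phase F \<Longrightarrow> poisson (\<lambda>q p. - F q p) G q p = - poisson F G q p"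
  by (simp add: poisson_def partial_uminus del: partial.simps)

text \<open>
  Expanding by the product rule gives terms in which \<open>partial c\<close> is the outer derivative of a
  gradient component; exchanging it with the inner one turns them into brackets again.
\<close>

lemma partial_poisson:
  assumes F: "polynomial_phase F" and G: "polynomial_phase G"
  shows "partial c (poisson F G) q p = poisson (partial c F) G q p + poisson F (partial c G) q p"
proof -
  have "partial c (poisson F G) q p =
     (\<Sum>j\<in>UNIV. partial c (partial (Pos j) F) q p * partial (Mom j) G q p
       + partial (Pos j) F q p * partial c (partial (Mom j) G) q p
       - partial c (partial (Mom j) F) q p * partial (Pos j) G q p
       - partial (Mom j) F q p * partial c (partial (Pos j) G) q p)"
    by (simp add: poisson_def[abs_def] sum_2 partial_add partial_diff partial_mult
        polynomial_phase_intros polynomial_phase_partial F G del: partial.simps)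
  also have "\<dots> = poisson (partial c F) G q p + poisson F (partial c G) q p"
    by (simp add: poisson_def sum_2 partial_commute[of _ c] F G algebra_simps del: partial.simps)
  finally show ?thesis .
qed

lemma compatible_if_bracket_const:
  assumes "polynomial_phase F" "polynomial_phase G"
    and "poisson F G = (\<lambda>q p. k)"
  shows "time_deriv G (flow_q F i) q p = time_deriv F (flow_q G i) q p"
    and "time_deriv G (flow_p F i) q p = time_deriv F (flow_p G i) q p"
proof -
  have bracket: "poisson (partial c F) G q p = poisson (partial c G) F q p" for c
    using partial_poisson[OF assms(1,2), of c q p] poisson_antisym[of F "partial c G" q p]
    by (simp add: assms(3) partial_const)
  have q: "flow_q H i = partial (Mom i) H" and p: "flow_p H i = (\<lambda>q p. - partial (Pos i) H q p)"
    for H by (simp_all add: fun_eq_iff flow_q_def flow_p_def)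
  show "time_deriv G (flow_q F i) q p = time_deriv F (flow_q G i) q p"
    by (simp only: time_deriv_eq_poisson q bracket)
  show "time_deriv G (flow_p F i) q p = time_deriv F (flow_p G i) q p"
    by (simp only: time_deriv_eq_poisson p bracket poisson_uminus_left polynomial_phase_partial
        assms(1,2))
qed

section \<open>Involution of the two Hamiltonians\<close>

lemma polynomial_K1: "polynomial_phase (K1 \<alpha>\<^sub>2 \<alpha>\<^sub>3)"
  unfolding K1_def[abs_def] by (intro polynomial_phase_intros)

lemma polynomial_K2: "polynomial_phase (K2 \<alpha>\<^sub>1 \<alpha>\<^sub>2 \<alpha>\<^sub>3)"
  unfolding K2_def[abs_def] by (intro polynomial_phase_intros)

lemma gradient_K1:
  "partial (Pos 1) (K1 \<alpha>\<^sub>2 \<alpha>\<^sub>3) q p = 2 * q$1 * p$1 + \<alpha>\<^sub>2"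
  "partial (Mom 1) (K1 \<alpha>\<^sub>2 \<alpha>\<^sub>3) q p = (q$1)^2 - 2 * p$1 + 3 / 2 * p$2"
  "partial (Pos 2) (K1 \<alpha>\<^sub>2 \<alpha>\<^sub>3) q p = - q$2 * p$2 - \<alpha>\<^sub>3 / 2"
  "partial (Mom 2) (K1 \<alpha>\<^sub>2 \<alpha>\<^sub>3) q p = - ((q$2)^2 / 2) - p$2 + 3 / 2 * p$1"
  unfolding partial.simps partial_q_def partial_p_def K1_def
  by (rule DERIV_imp_deriv, (auto intro!: derivative_eq_intros simp: field_simps)[1])+

lemma gradient_K2:
  "partial (Pos 1) (K2 \<alpha>\<^sub>1 \<alpha>\<^sub>2 \<alpha>\<^sub>3) q p =
     - p$2 * (8 * p$1 * q$2 * p$2 + 8 * q$1 * p$1 * p$2 + 4 * \<alpha>\<^sub>2 * p$2 + 4 * \<alpha>\<^sub>3 * p$1)"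
  "partial (Mom 1) (K2 \<alpha>\<^sub>1 \<alpha>\<^sub>2 \<alpha>\<^sub>3) q p =
     - (\<alpha>\<^sub>3^2) - p$2 * (8 * q$1 * q$2 * p$2 + 6 * (q$2)^2 * p$2 + 4 * (q$1)^2 * p$2
       + 2 * (p$2)^2 - 2 * p$1 * p$2 + 4 * \<alpha>\<^sub>3 * q$1 + 6 * \<alpha>\<^sub>3 * q$2)"
  "partial (Pos 2) (K2 \<alpha>\<^sub>1 \<alpha>\<^sub>2 \<alpha>\<^sub>3) q p =
     4 * (q$2)^3 * (p$2)^2 + 4 * q$2 * (p$2)^3 + 6 * \<alpha>\<^sub>3 * (q$2)^2 * p$2
     + 4 * (\<alpha>\<^sub>1 + \<alpha>\<^sub>3) * (p$2)^2 + 2 * \<alpha>\<^sub>3^2 * q$2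
     - p$2 * (8 * q$1 * p$1 * p$2 + 12 * p$1 * q$2 * p$2 + 6 * \<alpha>\<^sub>3 * p$1)"
  "partial (Mom 2) (K2 \<alpha>\<^sub>1 \<alpha>\<^sub>2 \<alpha>\<^sub>3) q p =
     2 * (q$2)^4 * p$2 + 6 * (q$2)^2 * (p$2)^2 + 4 * (p$2)^3 + 2 * \<alpha>\<^sub>3 * (q$2)^3
     + 8 * (\<alpha>\<^sub>1 + \<alpha>\<^sub>3) * q$2 * p$2 + \<alpha>\<^sub>3 * (2 * \<alpha>\<^sub>1 + \<alpha>\<^sub>3)
     - 2 * p$2 * (8 * q$1 * p$1 * q$2 + 6 * p$1 * (q$2)^2 + 4 * (q$1)^2 * p$1
       - (p$1)^2 + 4 * \<alpha>\<^sub>2 * q$1)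
     - 6 * p$1 * (p$2)^2 - 4 * \<alpha>\<^sub>3 * q$1 * p$1 - 6 * \<alpha>\<^sub>3 * p$1 * q$2"
  unfolding partial.simps partial_q_def partial_p_def K2_def
  by (rule DERIV_imp_deriv, (auto intro!: derivative_eq_intros
      simp: algebra_simps power2_eq_square power3_eq_cube power4_eq_xxxx)[1])+

text \<open>
  The second factor is a nonzero polynomial for all values of the parameters, so the Hamiltonians
  are in involution precisely when \<open>2\<alpha>\<^sub>1 + 2\<alpha>\<^sub>2 + \<alpha>\<^sub>3 = 0\<close>.
\<close>

lemma poisson_K1_K2:
  "poisson (K1 \<alpha>\<^sub>2 \<alpha>\<^sub>3) (K2 \<alpha>\<^sub>1 \<alpha>\<^sub>2 \<alpha>\<^sub>3) q p =
     (2 * \<alpha>\<^sub>1 + 2 * \<alpha>\<^sub>2 + \<alpha>\<^sub>3)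
     * (2 * (p$2)^3 - 3 * p$1 * (p$2)^2 - 3 * (q$2)^2 * (p$2)^2 - 3 * \<alpha>\<^sub>3 * q$2 * p$2 - \<alpha>\<^sub>3^2 / 2)"
  unfolding poisson_def gradient_K1 gradient_K2
  by (simp add: field_simps power2_eq_square power3_eq_cube power4_eq_xxxx)

theorem proposition5p1:
  fixes \<alpha>\<^sub>1 \<alpha>\<^sub>2 \<alpha>\<^sub>3 :: complex
  assumes "2 * \<alpha>\<^sub>1 + 2 * \<alpha>\<^sub>2 + \<alpha>\<^sub>3 = 0"
  shows "\<forall>i::2. \<forall>q p :: complex ^ 2.
     time_deriv (K2 \<alpha>\<^sub>1 \<alpha>\<^sub>2 \<alpha>\<^sub>3) (flow_q (K1 \<alpha>\<^sub>2 \<alpha>\<^sub>3) i) q p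
       = time_deriv (K1 \<alpha>\<^sub>2 \<alpha>\<^sub>3) (flow_q (K2 \<alpha>\<^sub>1 \<alpha>\<^sub>2 \<alpha>\<^sub>3) i) q p
   \<and> time_deriv (K2 \<alpha>\<^sub>1 \<alpha>\<^sub>2 \<alpha>\<^sub>3) (flow_p (K1 \<alpha>\<^sub>2 \<alpha>\<^sub>3) i) q p
       = time_deriv (K1 \<alpha>\<^sub>2 \<alpha>\<^sub>3) (flow_p (K2 \<alpha>\<^sub>1 \<alpha>\<^sub>2 \<alpha>\<^sub>3) i) q p"
proof -
  have "poisson (K1 \<alpha>\<^sub>2 \<alpha>\<^sub>3) (K2 \<alpha>\<^sub>1 \<alpha>\<^sub>2 \<alpha>\<^sub>3) = (\<lambda>q p. 0)"
    by (intro ext) (simp add: poisson_K1_K2 assms)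
  then show ?thesis
    by (intro allI conjI compatible_if_bracket_const polynomial_K1 polynomial_K2)
qed

end
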